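(* Let $\hat S\in\mathcal S$ be a follower solution, let $(i_1,i_2,\dots,i_T)$ be an arbitrary ordering of the items of $\hat S$, and let $\hat S_{(1)}=\emptyset$ and $\hat S_{(t)}=\{i_1,\dots,i_{t-1}\}$ for $2\le t\le T$. Then the improved submodular interdiction cut $$w\ \ge\ z(\hat S)-\sum_{t=1}^T\rho_{i_t}(\hat S_{(t)})\,x_{i_t}$$ is valid for the single-level model $\min\{w : w\ge\Phi(x),\ Ax\le b,\ x\in\{0,1\}^n\}$, i.e. every pair $(x,w)$ with $x\in X$, $w\in\mathbb R$, $w\ge\Phi(x)$ satisfies it. Moreover, it dominates the basic cut $w\ge z(\hat S)-\sum_{i\in\hat S}\rho_i(\emptyset)x_i$.
   Context: $N$ is a finite ground set of items and $z:2^N\to\mathbb R$ is a set function that is submodular ($z(S\cup\{i\})-z(S)\ge z(T\cup\{i\})-z(T)$ for all $S\subseteq T\subseteq N$, $i\in N\setminus T$) and non-decreasing ($z(S)\le z(T)$ for $S\subseteq T\subseteq N$). The marginal gain of $i\in N$ with respect to $S\subseteq N$ is $\rho_i(S)=z(S\cup\{i\})-z(S)$. Leader: $X=\{x\in\{0,1\}^n: Ax\le b\}$, where $A$ is a real matrix and $b$ a real vector of appropriate dimensions, and $n$ is the number of leader variables; there is a leader variable $x_i$ for every item $i\in N$. For $x\in X$, $N_x=\{i\in N: x_i=1\}$ is the set of interdicted items. Follower: for $\ell=1,\dots,L$ and $i\in N$ there are costs $c_i^\ell\ge 0$ and budgets $Q_\ell\in\mathbb R$; write $C(S)\le Q$ if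 $\sum_{i\in S}c_i^\ell\le Q_\ell$ for all $\ell=1,\dots,L$. The set of follower solutions is $\mathcal S=\{S\subseteq N: C(S)\le Q\}$. The follower's value function is $\Phi(x)=\max\{z(S): S\subseteq N\setminus N_x,\ C(S)\le Q\}$. A cut $w\ge f(x)$ dominates a cut $w\ge g(x)$ if $f(x)\ge g(x)$ for all $x\in X$. *)

theory Defs
  imports Jordan_Normal_Form.Matrix
begin

text \<open>
  Leader variables are the entries \<open>x $ 0, \<dots>, x $ (n - 1)\<close> of a real vector.  An item is
  identified with the index of its leader variable, so the ground set is some
  \<open>N \<subseteq> {..<n}\<close>; there may be leader variables that belong to no item.
\<close>

definition submodular_on :: "nat set \<Rightarrow> (nat set \<Rightarrow> real) \<Rightarrow> bool" where
  "submodular_on N z \<longleftrightarrow>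
     (\<forall>S T i. S \<subseteq> T \<and> T \<subseteq> N \<and> i \<in> N - T \<longrightarrow>
        z (S \<union> {i}) - z S \<ge> z (T \<union> {i}) - z T)"

definition nondecreasing_on :: "nat set \<Rightarrow> (nat set \<Rightarrow> real) \<Rightarrow> bool" where
  "nondecreasing_on N z \<longleftrightarrow> (\<forall>S T. S \<subseteq> T \<and> T \<subseteq> N \<longrightarrow> z S \<le> z T)"

definition marginal_gain :: "(nat set \<Rightarrow> real) \<Rightarrow> nat \<Rightarrow> nat set \<Rightarrow> real" where
  "marginal_gain z i S = z (S \<union> {i}) - z S"

definition leader_set :: "nat \<Rightarrow> real mat \<Rightarrow> real vec \<Rightarrow> real vec set" where
  "leader_set n A b = {x \<in> carrier_vec n. (\<forall>j<n. x $ j \<in> {0, 1}) \<and> A *\<^sub>v x \<le> b}"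

definition interdicted :: "nat set \<Rightarrow> real vec \<Rightarrow> nat set" where
  "interdicted N x = {i \<in> N. x $ i = 1}"

definition within_budget :: "nat \<Rightarrow> (nat \<Rightarrow> nat \<Rightarrow> real) \<Rightarrow> (nat \<Rightarrow> real) \<Rightarrow> nat set \<Rightarrow> bool" where
  "within_budget L c Q S \<longleftrightarrow> (\<forall>l\<in>{1..L}. (\<Sum>i\<in>S. c l i) \<le> Q l)"

definition follower_solutions ::
  "nat set \<Rightarrow> nat \<Rightarrow> (nat \<Rightarrow> nat \<Rightarrow> real) \<Rightarrow> (nat \<Rightarrow> real) \<Rightarrow> nat set set" where
  "follower_solutions N L c Q = {S. S \<subseteq> N \<and> within_budget L c Q S}"

text \<open>
  The maximum ranges over a finite set; with nonnegative costs it is nonempty as soon as there is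
  any follower solution, since then \<open>{}\<close> is one as well.
\<close>

definition follower_value ::
  "nat set \<Rightarrow> (nat set \<Rightarrow> real) \<Rightarrow> nat \<Rightarrow> (nat \<Rightarrow> nat \<Rightarrow> real) \<Rightarrow> (nat \<Rightarrow> real) \<Rightarrow> real vec \<Rightarrow> real" where
  "follower_value N z L c Q x =
     Max (z ` {S. S \<subseteq> N - interdicted N x \<and> within_budget L c Q S})"

definition single_level_feasible :: "real vec set \<Rightarrow> (real vec \<Rightarrow> real) \<Rightarrow> (real vec \<times> real) set" where
  "single_level_feasible X \<Phi> = {(x, w). x \<in> X \<and> w \<ge> \<Phi> x}"

text \<open>A cut \<open>w \<ge> f x\<close> is represented by its right-hand side \<open>f\<close>.\<close>

definition valid_cut :: "(real vec \<times> real) set \<Rightarrow> (real vec \<Rightarrow> real) \<Rightarrow> bool" where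
  "valid_cut F f \<longleftrightarrow> (\<forall>(x, w)\<in>F. w \<ge> f x)"

definition dominates :: "real vec set \<Rightarrow> (real vec \<Rightarrow> real) \<Rightarrow> (real vec \<Rightarrow> real) \<Rightarrow> bool" where
  "dominates X f g \<longleftrightarrow> (\<forall>x\<in>X. f x \<ge> g x)"

definition basic_cut :: "(nat set \<Rightarrow> real) \<Rightarrow> nat set \<Rightarrow> real vec \<Rightarrow> real" where
  "basic_cut z Shat x = z Shat - (\<Sum>i\<in>Shat. marginal_gain z i {} * x $ i)"

text \<open>
  For an ordering \<open>it 1, \<dots>, it T\<close> of the items of \<open>Shat\<close>, the set of items that
  precede \<open>it t\<close> is \<open>it ` {1..<t}\<close>, which is empty for \<open>t = 1\<close>.
\<close>

definition improved_cut ::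
  "(nat set \<Rightarrow> real) \<Rightarrow> nat set \<Rightarrow> nat \<Rightarrow> (nat \<Rightarrow> nat) \<Rightarrow> real vec \<Rightarrow> real" where
  "improved_cut z Shat T it x =
     z Shat - (\<Sum>t = 1..T. marginal_gain z (it t) (it ` {1..<t}) * x $ (it t))"

end

theory Submission
  imports Defs
begin

text \<open>
  Build the follower solution up one item at a time in the given order, and compare the value of the
  growing set with the value of its part that survives the interdiction. Adding an interdicted item
  leaves the surviving part unchanged, and the marginal gain of the item at that moment is exactly
  what the cut subtracts. Adding a surviving item changes both values, and the surviving part gains
  at least as much, because submodularity makes gains larger with respect to smaller sets.
  At the end, the right-hand side of the cut is at most the value of the surviving part
  (\<open>surviving_value_ge\<close>). By nonnegativity of the costs, that part is itself a follower solution
  (\<open>within_budget_subset\<close>) and so a lower bound on the follower's optimal value.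

  Dominance is diminishing returns once more: the gain of an item after its predecessors is at most
  its gain with respect to the empty set, and the coefficients multiply nonnegative variables.
\<close>

lemma marginal_gain_antimono:
  assumes "submodular_on N z" "S \<subseteq> U" "U \<subseteq> N" "i \<in> N - U"
  shows "marginal_gain z i U \<le> marginal_gain z i S"
  using assms unfolding submodular_on_def marginal_gain_def by blast

lemma within_budget_subset:
  assumes "within_budget L c Q S" "R \<subseteq> S" "finite S"
    and "\<And>l i. l \<in> {1..L} \<Longrightarrow> i \<in> S \<Longrightarrow> c l i \<ge> 0"
  shows "within_budget L c Q R"
  unfolding within_budget_def
proof
  fix l assume l: "l \<in> {1..L}"
  have "(\<Sum>i\<in>R. c l i) \<le> (\<Sum>i\<in>S. c l i)"
    using assms l by (intro sum_mono2) auto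
  also have "\<dots> \<le> Q l"
    using assms(1) l by (simp add: within_budget_def)
  finally show "(\<Sum>i\<in>R. c l i) \<le> Q l" .
qed

lemma predecessors_insert:
  "it ` {1..<Suc (Suc t)} = insert (it (Suc t)) (it ` {1..<Suc t})"
  by (auto simp: less_Suc_eq)

lemma not_in_predecessors:
  fixes t T :: nat
  assumes "inj_on it {1..T}" "t \<in> {1..T}"
  shows "it t \<notin> it ` {1..<t}"
  using assms by (fastforce dest: inj_onD)

text \<open>
  For \<open>k = T\<close>, with \<open>D\<close> the interdicted items, the left-hand side is the right-hand side of the
  improved cut. Stating the bound for all initial segments makes an induction on \<open>k\<close> possible, since
  the coefficient of an item refers only to the items before it.
\<close>

lemma surviving_value_ge:
  assumes sub: "submodular_on N z"
    and inj: "inj_on it {1..T}" and img: "it ` {1..T} \<subseteq> N"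
    and "k \<le> T"
  shows "z (it ` {1..<Suc k})
           - (\<Sum>t = 1..k. marginal_gain z (it t) (it ` {1..<t}) * of_bool (it t \<in> D))
         \<le> z (it ` {1..<Suc k} - D)"
  using \<open>k \<le> T\<close>
proof (induction k)
  case 0
  then show ?case by simp
next
  case (Suc k)
  let ?i = "it (Suc k)" and ?P = "it ` {1..<Suc k}"
  have new: "?i \<notin> ?P"
    using not_in_predecessors[OF inj, of "Suc k"] Suc.prems by simp
  have PN: "?P \<subseteq> N" and iN: "?i \<in> N"
    using img Suc.prems by auto
  have IH: "z ?P - (\<Sum>t = 1..k. marginal_gain z (it t) (it ` {1..<t}) * of_bool (it t \<in> D))
              \<le> z (?P - D)"
    using Suc by simp
  have gain: "z (insert ?i S) = z S + marginal_gain z ?i S" for S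
    by (simp add: marginal_gain_def)
  show ?case
  proof (cases "?i \<in> D")
    case True
    then have "insert ?i ?P - D = ?P - D" by auto
    then show ?thesis
      using IH True by (simp only: predecessors_insert gain) simp
  next
    case False
    then have "insert ?i ?P - D = insert ?i (?P - D)" by auto
    moreover have "marginal_gain z ?i ?P \<le> marginal_gain z ?i (?P - D)"
      using new PN iN by (intro marginal_gain_antimono[OF sub]) auto
    ultimately show ?thesis
      using IH False by (simp only: predecessors_insert gain) simp
  qed
qed

lemma follower_value_ge:
  assumes "finite N" "S \<subseteq> N - interdicted N x" "within_budget L c Q S"
  shows "z S \<le> follower_value N z L c Q x"
  unfolding follower_value_def
proof (rule Max_ge)
  have "{S. S \<subseteq> N - interdicted N x \<and> within_budget L c Q S} \<subseteq> Pow N" by auto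
  then show "finite (z ` {S. S \<subseteq> N - interdicted N x \<and> within_budget L c Q S})"
    using assms(1) by (meson finite_Pow_iff finite_imageI finite_subset)
  show "z S \<in> z ` {S. S \<subseteq> N - interdicted N x \<and> within_budget L c Q S}"
    using assms by blast
qed

theorem theorem2:
  fixes n m L T :: nat
    and A :: "real mat" and b :: "real vec"
    and N Shat :: "nat set" and z :: "nat set \<Rightarrow> real"
    and c :: "nat \<Rightarrow> nat \<Rightarrow> real" and Q :: "nat \<Rightarrow> real"
    and it :: "nat \<Rightarrow> nat"
  assumes "A \<in> carrier_mat m n" and "b \<in> carrier_vec m"
    and "N \<subseteq> {..<n}"
    and "submodular_on N z" and "nondecreasing_on N z"
    and "\<And>l i. l \<in> {1..L} \<Longrightarrow> i \<in> N \<Longrightarrow> c l i \<ge> 0"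
    and "Shat \<in> follower_solutions N L c Q"
    and "bij_betw it {1..T} Shat"
  shows "valid_cut (single_level_feasible (leader_set n A b) (follower_value N z L c Q))
           (improved_cut z Shat T it)
       \<and> dominates (leader_set n A b) (improved_cut z Shat T it) (basic_cut z Shat)"
proof -
  have SN: "Shat \<subseteq> N" and budget: "within_budget L c Q Shat"
    using assms(7) by (auto simp: follower_solutions_def)
  have finN: "finite N" using assms(3) finite_subset by blast
  have finS: "finite Shat" using SN finN by (rule finite_subset)
  have inj: "inj_on it {1..T}" and img: "it ` {1..T} = Shat"
    using assms(8) by (auto simp: bij_betw_def)
  have itN: "it t \<in> N" if "t \<in> {1..T}" for t
    using img SN that by blast
  have binary: "x $ i \<in> {0, 1}" if "x \<in> leader_set n A b" "i \<in> N" for x i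
    using that assms(3) by (auto simp: leader_set_def)
  have "improved_cut z Shat T it x \<le> follower_value N z L c Q x"
    if x: "x \<in> leader_set n A b" for x
  proof -
    let ?D = "interdicted N x"
    have "x $ it t = of_bool (it t \<in> ?D)" if "t \<in> {1..T}" for t
      using binary[OF x itN[OF that]] itN[OF that] by (auto simp: interdicted_def)
    then have "improved_cut z Shat T it x = z Shat
        - (\<Sum>t = 1..T. marginal_gain z (it t) (it ` {1..<t}) * of_bool (it t \<in> ?D))"
      unfolding improved_cut_def by (intro arg_cong2[of _ _ _ _ "(-)"] sum.cong) simp_all
    also have "\<dots> \<le> z (Shat - ?D)"
      using surviving_value_ge[OF assms(4) inj, of T ?D] img SN
      by (simp add: atLeastLessThanSuc_atLeastAtMost)
    also have "\<dots> \<le> follower_value N z L c Q x"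
    proof (rule follower_value_ge[OF finN])
      show "Shat - ?D \<subseteq> N - ?D" using SN by blast
      show "within_budget L c Q (Shat - ?D)"
        using budget Diff_subset finS by (rule within_budget_subset) (use assms(6) SN in blast)
    qed
    finally show ?thesis .
  qed
  then have valid: "valid_cut (single_level_feasible (leader_set n A b) (follower_value N z L c Q))
      (improved_cut z Shat T it)"
    unfolding valid_cut_def single_level_feasible_def by fastforce
  have "basic_cut z Shat x \<le> improved_cut z Shat T it x" if x: "x \<in> leader_set n A b" for x
  proof -
    have "(\<Sum>t = 1..T. marginal_gain z (it t) (it ` {1..<t}) * x $ it t)
        \<le> (\<Sum>t = 1..T. marginal_gain z (it t) {} * x $ it t)"
    proof (intro sum_mono mult_right_mono)
      fix t assume t: "t \<in> {1..T}"
      have "it ` {1..<t} \<subseteq> N"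
        using itN t by auto
      then show "marginal_gain z (it t) (it ` {1..<t}) \<le> marginal_gain z (it t) {}"
        using itN[OF t] not_in_predecessors[OF inj t]
        by (intro marginal_gain_antimono[OF assms(4)]) auto
      show "0 \<le> x $ it t"
        using binary[OF x itN[OF t]] by auto
    qed
    also have "\<dots> = (\<Sum>i\<in>Shat. marginal_gain z i {} * x $ i)"
      using assms(8) by (rule sum.reindex_bij_betw)
    finally show ?thesis
      by (simp add: basic_cut_def improved_cut_def)
  qed
  then show ?thesis
    using valid by (simp add: dominates_def)
qed

end
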